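(* Let $f\in C^3(\mathbb{R}^n;\mathbb{R}^n)$, let $\mathcal{T}=\{\mathfrak{S}_\nu\}_\nu$ be a triangulation in $\mathbb{R}^n$, and let $\mu\ge 0$. Assume that $\{P(x_k)\}$, $\{C_\nu\}$, $\{D_\nu\}$ is a feasible solution to Optimization Problem 1 (defined in the context) with parameter $\mu$, and let $P:\mathcal{D}_{\mathcal{T}}\to\mathbb{R}^{n\times n}$ be the CPA interpolation of the values $P(x_k)$. For every $x\in\mathcal{D}_{\mathcal{T}}^\circ$ define $$A(x):=P(x)\,\mathrm{D}f(x)+\mathrm{D}f(x)^{\top}P(x)+\bigl(w^\nu_{ij}\cdot f(x)\bigr)_{i,j=1,\ldots,n},$$ where $\mathfrak{S}_\nu\in\mathcal{T}$ is a simplex for which there is $\theta^*>0$ with $x+\theta f(x)\in\mathfrak{S}_\nu$ for all $\theta\in[0,\theta^*]$. Denote by $\lambda_{\max}(x)$ the largest generalized eigenvalue of the matrix pair $(A(x),P(x))$. Then $\mu\ge\lambda_{\max}(x)$ for every $x\in\mathcal{D}_{\mathcal{T}}^\circ$.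
   Context: **Simplices and triangulations.** For affinely independent $x_0,\ldots,x_n\in\mathbb{R}^n$, the convex hull $\mathfrak{S}=\operatorname{co}(x_0,\ldots,x_n)$ is called a simplex; the convex hull of a nonempty proper subset of its vertices is called a face. A triangulation in $\mathbb{R}^n$ is a finite set $\mathcal{T}=\{\mathfrak{S}_\nu\}_\nu$ of ($n$-)simplices such that two different simplices of $\mathcal{T}$ intersect in a common face or not at all, and such that the interior $\mathcal{D}_{\mathcal{T}}^\circ$ of $\mathcal{D}_{\mathcal{T}}:=\bigcup_{\nu}\mathfrak{S}_\nu$ is connected. **CPA interpolation.** Given values $P(x_k)$ at all vertices of the simplices of $\mathcal{T}$, write $x\in\mathfrak{S}_\nu=\operatorname{co}(x_0,\ldots,x_n)$ uniquely as $x=\sum_{k=0}^n\lambda_kx_k$ with $\lambda_k\in[0,1]$, $\sum_k\lambda_k=1$, and put $P(x):=\sum_{k=0}^n\lambda_kP(x_k)$ (entrywise for matrices). The function $P_{ij}$ is affine on each $\mathfrak{S}_\nu$, and $w^\nu_{ij}\in\mathbb{R}^n$ denotes its constant gradient $\nabla P_{ij}|_{\mathfrak{S}_\nu}$ there. (For every $x\in\mathcal{D}_{\mathcal{T}}^\circ$ a simplex $\mathfrak{S}_\nu\in\mathcal{T}$ and $\theta^*>0$ with $x+\theta f(x)\in\mathfrak{S}_\nu$ for all $\theta\in[0,\theta^*]$ exist.) **Notation.** $I$ is the identity matrix; for symmetric matrices, $A\succeq B$ means $A-B$ is positive semidefinite. $\mathrm{D}f$ is the Jacobian matrix of $f=(f_1,\ldots,f_n)^\top$.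 For symmetric $A,B$ with $B$ positive definite, a generalized eigenvalue of $(A,B)$ is $\lambda\in\mathbb{R}$ such that $Av=\lambda Bv$ for some $v\ne0$. **Optimization Problem 1** (for $f$, $\mathcal{T}$, $\mu\ge 0$). Constants: $\epsilon_0>0$; $h_\nu:=\operatorname{diam}(\mathfrak{S}_\nu)=\max_{x,y\in\mathfrak{S}_\nu}\|x-y\|_2$; numbers $B_\nu\ge\max_{x\in\mathfrak{S}_\nu,\ i,j,k}\left|\frac{\partial^2f_k(x)}{\partial x_i\partial x_j}\right|$ and $B_{3,\nu}\ge\max_{x\in\mathfrak{S}_\nu,\ i,j,k,l}\left|\frac{\partial^3f_l(x)}{\partial x_i\partial x_j\partial x_k}\right|$. Variables: a symmetric matrix $P(x_k)=(P_{ij}(x_k))\in\mathbb{R}^{n\times n}$ for each vertex $x_k$ of the simplices of $\mathcal{T}$, and numbers $C_\nu,D_\nu\ge0$ for each $\mathfrak{S}_\nu\in\mathcal{T}$. A feasible solution is a choice of the variables satisfying, for each $\mathfrak{S}_\nu=\operatorname{co}(x_0,\ldots,x_n)\in\mathcal{T}$ and each vertex $x_k$ of $\mathfrak{S}_\nu$: 1. $P(x_k)\succeq\epsilon_0I$; 2. $P(x_k)\preceq C_\nu I$; 3. $\|w^\nu_{ij}\|_1\le D_\nu$ for all $1\le i\le j\le n$; 4. $0\succeq A(x_k)-\mu P(x_k)+h_\nu^2E_\nu I$, where (for the simplex $\mathfrak{S}_\nu$ under consideration) $A(x_k):=P(x_k)\mathrm{D}f(x_k)+\mathrm{D}f(x_k)^\top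 P(x_k)+(w^\nu_{ij}\cdot f(x_k))_{i,j=1,\ldots,n}$ and $E_\nu:=n^2\left[(1+4\sqrt n)B_\nu D_\nu+2nB_{3,\nu}C_\nu\right]$. *)

theory Defs
  imports "HOL-Analysis.Analysis"
begin

section \<open>Partial derivatives and smoothness\<close>

definition partial :: "'n \<Rightarrow> (real^'n \<Rightarrow> real) \<Rightarrow> real^'n \<Rightarrow> real" where
  "partial i g x = frechet_derivative g (at x) (axis i 1)"

primrec C_fun :: "nat \<Rightarrow> (real^'n \<Rightarrow> real) \<Rightarrow> bool" where
  "C_fun 0 g \<longleftrightarrow> continuous_on UNIV g"
| "C_fun (Suc k) g \<longleftrightarrow> (\<forall>x. g differentiable (at x)) \<and> (\<forall>i. C_fun k (partial i g))"

definition C_map :: "nat \<Rightarrow> (real^'n \<Rightarrow> real^'m) \<Rightarrow> bool" where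
  "C_map k f \<longleftrightarrow> (\<forall>l. C_fun k (\<lambda>x. f x $ l))"


section \<open>Triangulations\<close>

definition vertices :: "'a::euclidean_space set \<Rightarrow> 'a set" where
  "vertices S = {v. v extreme_point_of S}"

lemma vertices_convex_hull:
  fixes C :: "'a::euclidean_space set"
  assumes "\<not> affine_dependent C"
  shows "vertices (convex hull C) = C"
  using assms by (simp add: vertices_def extreme_point_of_convex_hull_affine_independent)

definition simplex_face :: "'a::euclidean_space set \<Rightarrow> 'a set \<Rightarrow> bool" where
  "simplex_face F S \<longleftrightarrow> (\<exists>V. V \<noteq> {} \<and> V \<subset> vertices S \<and> F = convex hull V)"

text \<open>Unlike the library's \<open>triangulation\<close>, all simplices are full-dimensional and the
  interior of their union is connected.\<close>

definition full_triangulation :: "(real^'n) set set \<Rightarrow> bool" where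
  "full_triangulation T \<longleftrightarrow>
     finite T \<and>
     (\<forall>S\<in>T. int CARD('n) simplex S) \<and>
     (\<forall>S\<in>T. \<forall>S'\<in>T. S \<noteq> S' \<longrightarrow>
        S \<inter> S' = {} \<or> (simplex_face (S \<inter> S') S \<and> simplex_face (S \<inter> S') S')) \<and>
     connected (interior (\<Union>T))"

text \<open>The simplex used in the definition of \<open>A(x)\<close> always exists.\<close>

lemma full_triangulation_direction:
  fixes T :: "(real^'n) set set"
  assumes T: "full_triangulation T" and x: "x \<in> interior (\<Union>T)"
  shows "\<exists>S\<in>T. \<exists>\<theta>>0. \<forall>t\<in>{0..\<theta>}. x + t *\<^sub>R v \<in> S"
proof -
  define y where "y m = x + inverse (real (Suc m)) *\<^sub>R v" for m
  have "(\<lambda>m. x + inverse (real (Suc m)) *\<^sub>R v) \<longlonglongrightarrow> x + 0 *\<^sub>R v"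
    by (intro tendsto_intros LIMSEQ_inverse_real_of_nat)
  then have lim: "y \<longlonglongrightarrow> x" by (simp add: y_def[abs_def])
  have "eventually (\<lambda>m. y m \<in> interior (\<Union>T)) sequentially"
    using topological_tendstoD[OF lim _ x] by simp
  then obtain N where N: "\<And>m. m \<ge> N \<Longrightarrow> y m \<in> \<Union>T"
    unfolding eventually_sequentially using interior_subset by blast
  have "{N..} \<subseteq> (\<Union>S\<in>T. {m. y m \<in> S})" using N by auto
  then have "infinite (\<Union>S\<in>T. {m. y m \<in> S})"
    using infinite_Ici finite_subset by blast
  moreover have "finite T" using T by (simp add: full_triangulation_def)
  ultimately obtain S where S: "S \<in> T" "infinite {m. y m \<in> S}" by blast
  have "int CARD('n) simplex S" using T S(1) by (simp add: full_triangulation_def)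
  then have "closed S" "convex S"
    by (auto simp: simplex compact_imp_closed finite_imp_compact_convex_hull)
  have freq: "\<exists>m\<ge>k. y m \<in> S" for k
    using S(2) unfolding infinite_nat_iff_unbounded_le by simp
  have "x \<in> S"
  proof (rule ccontr)
    assume "x \<notin> S"
    then have "eventually (\<lambda>m. y m \<in> - S) sequentially"
      using topological_tendstoD[OF lim, of "- S"] \<open>closed S\<close> by (simp add: open_Compl)
    then show False
      using freq unfolding eventually_sequentially by blast
  qed
  obtain m where m: "y m \<in> S" using freq by blast
  have "x + t *\<^sub>R v \<in> S" if "t \<in> {0..inverse (real (Suc m))}" for t
  proof -
    define s where "s = t * real (Suc m)"
    have s: "0 \<le> s" "s \<le> 1" using that by (auto simp: s_def field_simps)
    have "(1 - s) *\<^sub>R x + s *\<^sub>R y m \<in> S"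
      using \<open>convex S\<close> \<open>x \<in> S\<close> m s by (simp add: convex_def)
    moreover have "(1 - s) *\<^sub>R x + s *\<^sub>R y m = x + t *\<^sub>R v"
      by (simp add: y_def s_def algebra_simps del: of_nat_Suc)
    ultimately show ?thesis by simp
  qed
  then show ?thesis using S(1)
    by (intro bexI[of _ S] exI[of _ "inverse (real (Suc m))"]) auto
qed


section \<open>CPA interpolation\<close>

text \<open>Only the values of \<open>p\<close> at the vertices of \<open>T\<close> matter; \<open>u\<close> are the barycentric
  coordinates of \<open>x\<close>.\<close>

definition cpa :: "(real^'n) set set \<Rightarrow> (real^'n \<Rightarrow> 'b::real_vector) \<Rightarrow> real^'n \<Rightarrow> 'b" where
  "cpa T p x = (THE y. \<exists>S\<in>T. \<exists>u.
     (\<forall>v\<in>vertices S. 0 \<le> u v \<and> u v \<le> 1) \<and> (\<Sum>v\<in>vertices S. u v) = 1 \<and>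
     x = (\<Sum>v\<in>vertices S. u v *\<^sub>R v) \<and> y = (\<Sum>v\<in>vertices S. u v *\<^sub>R p v))"

text \<open>The gradient on \<open>S\<close> of a function that is affine on \<open>S\<close>, read off in the interior.\<close>

definition simplex_gradient :: "(real^'n) set \<Rightarrow> (real^'n \<Rightarrow> real) \<Rightarrow> real^'n" where
  "simplex_gradient S g = (THE w. \<forall>x\<in>interior S. GDERIV g x :> w)"

definition cpa_gradient ::
  "(real^'n) set set \<Rightarrow> (real^'n \<Rightarrow> real^'n^'n) \<Rightarrow> (real^'n) set \<Rightarrow> 'n \<Rightarrow> 'n \<Rightarrow> real^'n" where
  "cpa_gradient T p S i j = simplex_gradient S (\<lambda>x. cpa T p x $ i $ j)"


section \<open>Matrices\<close>

definition symmetric_matrix :: "real^'n^'n \<Rightarrow> bool" where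
  "symmetric_matrix A \<longleftrightarrow> transpose A = A"

definition pos_semidef :: "real^'n^'n \<Rightarrow> bool" where
  "pos_semidef A \<longleftrightarrow> symmetric_matrix A \<and> (\<forall>v. 0 \<le> v \<bullet> (A *v v))"

definition loewner_ge :: "real^'n^'n \<Rightarrow> real^'n^'n \<Rightarrow> bool" where
  "loewner_ge A B \<longleftrightarrow> pos_semidef (A - B)"

definition gen_eigenvalues :: "real^'n^'n \<Rightarrow> real^'n^'n \<Rightarrow> real set" where
  "gen_eigenvalues A B = {c. \<exists>v. v \<noteq> 0 \<and> A *v v = c *\<^sub>R (B *v v)}"

definition max_gen_eigenvalue :: "real^'n^'n \<Rightarrow> real^'n^'n \<Rightarrow> real" where
  "max_gen_eigenvalue A B = Max (gen_eigenvalues A B)"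

text \<open>The matrix \<open>A(x)\<close>, for \<open>M = P(x)\<close> and the gradients \<open>w i j\<close> on the chosen simplex.\<close>

definition A_matrix ::
  "(real^'n \<Rightarrow> real^'n) \<Rightarrow> ('n \<Rightarrow> 'n \<Rightarrow> real^'n) \<Rightarrow> real^'n^'n \<Rightarrow> real^'n \<Rightarrow> real^'n^'n" where
  "A_matrix f w M x =
     M ** jacobian f (at x) + transpose (jacobian f (at x)) ** M + (\<chi> i j. w i j \<bullet> f x)"


section \<open>The optimization problem\<close>

definition bounds_second ::
  "(real^'n \<Rightarrow> real^'n) \<Rightarrow> (real^'n) set set \<Rightarrow> ((real^'n) set \<Rightarrow> real) \<Rightarrow> bool" where
  "bounds_second f T B \<longleftrightarrow> (\<forall>S\<in>T. \<forall>x\<in>S. \<forall>i j k.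
     \<bar>partial i (partial j (\<lambda>z. f z $ k)) x\<bar> \<le> B S)"

definition bounds_third ::
  "(real^'n \<Rightarrow> real^'n) \<Rightarrow> (real^'n) set set \<Rightarrow> ((real^'n) set \<Rightarrow> real) \<Rightarrow> bool" where
  "bounds_third f T B3 \<longleftrightarrow> (\<forall>S\<in>T. \<forall>x\<in>S. \<forall>i j k l.
     \<bar>partial i (partial j (partial k (\<lambda>z. f z $ l))) x\<bar> \<le> B3 S)"

definition E_const :: "'n itself \<Rightarrow> real \<Rightarrow> real \<Rightarrow> real \<Rightarrow> real \<Rightarrow> real" where
  "E_const _ B B3 C D = (let n = real CARD('n) in
     n\<^sup>2 * ((1 + 4 * sqrt n) * B * D + 2 * n * B3 * C))"

text \<open>In the gradient bound all pairs \<open>(i, j)\<close> are taken instead of \<open>i \<le> j\<close>, as the index type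
  carries no order; the matrices \<open>p v\<close> being symmetric, the gradients are symmetric in \<open>i\<close>
  and \<open>j\<close>.\<close>

definition feasible ::
  "(real^'n \<Rightarrow> real^'n) \<Rightarrow> (real^'n) set set \<Rightarrow> real \<Rightarrow> real \<Rightarrow>
   ((real^'n) set \<Rightarrow> real) \<Rightarrow> ((real^'n) set \<Rightarrow> real) \<Rightarrow>
   (real^'n \<Rightarrow> real^'n^'n) \<Rightarrow> ((real^'n) set \<Rightarrow> real) \<Rightarrow> ((real^'n) set \<Rightarrow> real) \<Rightarrow> bool" where
  "feasible f T \<mu> \<epsilon> B B3 p C D \<longleftrightarrow> (\<forall>S\<in>T.
     0 \<le> C S \<and> 0 \<le> D S \<and>
     (\<forall>i j. (\<Sum>k\<in>UNIV. \<bar>cpa_gradient T p S i j $ k\<bar>) \<le> D S) \<and>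
     (\<forall>v\<in>vertices S.
        symmetric_matrix (p v) \<and>
        loewner_ge (p v) (\<epsilon> *\<^sub>R mat 1) \<and>
        loewner_ge (C S *\<^sub>R mat 1) (p v) \<and>
        loewner_ge 0 (A_matrix f (cpa_gradient T p S) (p v) v - \<mu> *\<^sub>R p v
          + ((diameter S)\<^sup>2 * E_const TYPE('n) (B S) (B3 S) (C S) (D S)) *\<^sub>R mat 1)))"

end

theory Submission
  imports Defs
begin

text \<open>
  Everything reduces to the inequality \<open>q \<bullet> A(x) q \<le> \<mu> q \<bullet> P(x) q\<close> for all vectors \<open>q\<close>, since a
  generalized eigenvector \<open>q\<close> with eigenvalue \<open>c\<close> turns it into \<open>c (q \<bullet> P(x) q) \<le> \<mu> (q \<bullet> P(x) q)\<close>,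
  where \<open>P(x)\<close> is positive definite as a convex combination of the matrices at the vertices. That
  the largest generalized eigenvalue exists at all rests on the symmetry of \<open>A(x)\<close> and \<open>P(x)\<close>
  (\<open>max_gen_eigenvalue_le\<close>).

  At the vertices of the simplex \<open>S\<close> the inequality is a constraint of the optimization problem,
  with a margin \<open>h\<^sup>2 E\<close> to spare. Writing \<open>x = \<Sum> u\<^sub>v v\<close> in barycentric coordinates, the
  convex combination \<open>\<Sum> u\<^sub>v A(v)\<close> satisfies it with the same margin, because
  \<open>P(x) = \<Sum> u\<^sub>v P(v)\<close>. The margin absorbs the interpolation error \<open>A(x) - \<Sum> u\<^sub>v A(v)\<close>, which
  is quadratic in the diameter \<open>h\<close> of \<open>S\<close> (\<open>A_matrix_interpolation_error\<close>):

  \<^item> Linear interpolation of a scalar function at \<open>x\<close> kills the first-order Taylor terms around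
    \<open>x\<close>, so it has error at most \<open>n b h\<^sup>2 / 2\<close> if \<open>b\<close> bounds the second partial derivatives
    (\<open>abs_linear_interpolation_error_le\<close>). This is used for \<open>f\<close>, with \<open>b = B\<close>, and for its first
    partial derivatives, with \<open>b = B\<^sub>3\<close>.

  \<^item> For the products of an entry of \<open>P\<close> with a partial derivative of \<open>f\<close> there is in addition the
    product of the two oscillations over \<open>S\<close>, at most \<open>D h\<close> and \<open>\<surd>n B h\<close>
    (\<open>abs_product_interpolation_error_le\<close>).

  The oscillation of an entry of \<open>P\<close> is at most \<open>D h\<close> because \<open>P\<close> is affine on \<open>S\<close> with the gradients
  \<open>w i j\<close> (\<open>cpa_entry_affine\<close>); this in turn depends on the interpolation being well defined on
  shared faces (\<open>cpa_eq\<close>). All errors are estimated entry by entry, and passing from entries to the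
  quadratic form costs a factor \<open>n\<close> (\<open>abs_quadratic_form_le\<close>).
\<close>

section \<open>Quadratic forms and generalized eigenvalues\<close>

text \<open>Cauchy-Schwarz for the vector of absolute values and the all-ones vector.\<close>

lemma sum_abs_components_le:
  fixes v :: "real^'n"
  shows "(\<Sum>i\<in>UNIV. \<bar>v $ i\<bar>) \<le> sqrt (real CARD('n)) * norm v"
proof -
  define a one :: "real^'n" where "a = (\<chi> i. \<bar>v $ i\<bar>)" and "one = (\<chi> i. 1)"
  have "(\<Sum>i\<in>UNIV. \<bar>v $ i\<bar>) = one \<bullet> a"
    by (simp add: a_def one_def inner_vec_def)
  also have "\<dots> \<le> norm one * norm a" by (rule norm_cauchy_schwarz)
  also have "norm one = sqrt (real CARD('n))" by (simp add: one_def norm_vec_def L2_set_def)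
  also have "norm a = norm v" by (simp add: a_def norm_vec_def)
  finally show ?thesis .
qed

lemma inner_matrix_vector_eq_sum:
  fixes M :: "real^'n^'m"
  shows "u \<bullet> (M *v v) = (\<Sum>i\<in>UNIV. \<Sum>j\<in>UNIV. u $ i * M $ i $ j * v $ j)"
  by (simp add: inner_vec_def matrix_vector_mult_def sum_distrib_left mult.assoc)

text \<open>Majorizing every entry by \<open>b\<close> leaves \<open>b\<close> times the squared 1-norm of \<open>v\<close>, which is at most
  \<open>n\<close> times its squared Euclidean norm.\<close>

lemma abs_quadratic_form_le:
  fixes M :: "real^'n^'n"
  assumes "\<And>i j. \<bar>M $ i $ j\<bar> \<le> b"
  shows "\<bar>v \<bullet> (M *v v)\<bar> \<le> real CARD('n) * b * (v \<bullet> v)"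
proof -
  let ?s = "\<Sum>i\<in>UNIV. \<bar>v $ i\<bar>"
  have b: "0 \<le> b" using assms abs_ge_zero order_trans by blast
  have "\<bar>v \<bullet> (M *v v)\<bar> \<le> (\<Sum>i\<in>UNIV. \<Sum>j\<in>UNIV. \<bar>v $ i * M $ i $ j * v $ j\<bar>)"
    unfolding inner_matrix_vector_eq_sum
    by (rule order_trans[OF sum_abs sum_mono[OF sum_abs]])
  also have "\<dots> \<le> (\<Sum>i\<in>UNIV. \<Sum>j\<in>UNIV. b * (\<bar>v $ i\<bar> * \<bar>v $ j\<bar>))"
  proof (intro sum_mono)
    fix i j
    have "\<bar>M $ i $ j\<bar> * (\<bar>v $ i\<bar> * \<bar>v $ j\<bar>) \<le> b * (\<bar>v $ i\<bar> * \<bar>v $ j\<bar>)"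
      by (intro mult_right_mono assms) auto
    then show "\<bar>v $ i * M $ i $ j * v $ j\<bar> \<le> b * (\<bar>v $ i\<bar> * \<bar>v $ j\<bar>)"
      by (simp add: abs_mult ac_simps)
  qed
  also have "\<dots> = b * ?s\<^sup>2"
    by (simp only: power2_eq_square sum_product) (simp add: sum_distrib_left)
  also have "\<dots> \<le> b * (sqrt (real CARD('n)) * norm v)\<^sup>2"
    by (intro mult_left_mono power_mono sum_abs_components_le sum_nonneg b) auto
  also have "\<dots> = real CARD('n) * b * (v \<bullet> v)"
    by (simp add: power_mult_distrib power2_norm_eq_inner)
  finally show ?thesis .
qed

lemma symmetric_matrix_component:
  "symmetric_matrix M \<longleftrightarrow> (\<forall>i j. M $ i $ j = M $ j $ i)"
  unfolding symmetric_matrix_def transpose_def vec_eq_iff by auto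

lemma symmetric_matrix_inner_swap:
  fixes M :: "real^'n^'n"
  assumes "symmetric_matrix M"
  shows "u \<bullet> (M *v v) = v \<bullet> (M *v u)"
  using assms by (metis dot_lmul_matrix inner_commute symmetric_matrix_def transpose_matrix_vector)

text \<open>Polarization: evaluating the form at the sum and at the difference of two standard basis vectors
  isolates the entry.\<close>

lemma abs_entry_le_of_quadratic_form_bounds:
  fixes P :: "real^'n^'n"
  assumes sym: "symmetric_matrix P"
    and nonneg: "\<And>v. 0 \<le> v \<bullet> (P *v v)"
    and le: "\<And>v. v \<bullet> (P *v v) \<le> c * (v \<bullet> v)"
  shows "\<bar>P $ i $ j\<bar> \<le> c"
proof -
  let ?e = "\<lambda>i. axis i 1 :: real^'n"
  have entry: "?e k \<bullet> (P *v ?e l) = P $ k $ l" for k l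
    by (simp add: inner_axis' matrix_vector_mul_component inner_axis)
  have "(?e i + ?e j) \<bullet> (P *v (?e i + ?e j)) = P$i$i + P$j$j + 2 * P$i$j"
    "(?e i - ?e j) \<bullet> (P *v (?e i - ?e j)) = P$i$i + P$j$j - 2 * P$i$j"
    using sym by (simp_all add: matrix_vector_right_distrib matrix_vector_mult_diff_distrib
        inner_add_left inner_add_right inner_diff_left inner_diff_right entry
        symmetric_matrix_component)
  moreover have "(?e i + ?e j) \<bullet> (?e i + ?e j) + (?e i - ?e j) \<bullet> (?e i - ?e j) = 4"
    by (simp add: inner_add_left inner_add_right inner_diff_left inner_diff_right inner_axis_axis)
  moreover have "c * ((?e i + ?e j) \<bullet> (?e i + ?e j)) + c * ((?e i - ?e j) \<bullet> (?e i - ?e j)) = c * 4"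
    using calculation(3) by (metis distrib_left)
  ultimately show ?thesis
    using nonneg[of "?e i + ?e j"] nonneg[of "?e i - ?e j"]
      le[of "?e i + ?e j"] le[of "?e i - ?e j"] by linarith
qed

text \<open>Eigenvectors for distinct generalized eigenvalues are orthogonal with respect to the inner product
  given by \<open>P\<close>, hence linearly independent, so there are at most \<open>n\<close> eigenvalues.\<close>

lemma finite_gen_eigenvalues:
  fixes A P :: "real^'n^'n"
  assumes A: "symmetric_matrix A" and P: "symmetric_matrix P"
    and pos: "\<And>v. v \<noteq> 0 \<Longrightarrow> 0 < v \<bullet> (P *v v)"
  shows "finite (gen_eigenvalues A P)"
proof (rule ccontr)
  assume "infinite (gen_eigenvalues A P)"
  then obtain F where F: "F \<subseteq> gen_eigenvalues A P" "finite F" "card F = Suc CARD('n)"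
    using infinite_arbitrarily_large by blast
  have "\<forall>c\<in>F. \<exists>v. v \<noteq> 0 \<and> A *v v = c *\<^sub>R (P *v v)"
    using F(1) by (auto simp: gen_eigenvalues_def)
  then obtain e where e: "\<And>c. c \<in> F \<Longrightarrow> e c \<noteq> 0 \<and> A *v e c = c *\<^sub>R (P *v e c)"
    by metis
  have orth: "e c \<bullet> (P *v e d) = 0" if "c \<in> F" "d \<in> F" "c \<noteq> d" for c d
  proof -
    have "d * (e c \<bullet> (P *v e d)) = e c \<bullet> (A *v e d)" using e that by simp
    also have "\<dots> = e d \<bullet> (A *v e c)" by (rule symmetric_matrix_inner_swap[OF A])
    also have "\<dots> = c * (e d \<bullet> (P *v e c))" using e that by simp
    also have "\<dots> = c * (e c \<bullet> (P *v e d))" using symmetric_matrix_inner_swap[OF P] by metis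
    finally show ?thesis using that by simp
  qed
  have inj: "inj_on e F"
    by (rule inj_onI) (metis e orth pos less_irrefl)
  have "independent (e ` F)"
  proof (rule independent_if_scalars_zero)
    fix a y assume sum0: "(\<Sum>x\<in>e ` F. a x *\<^sub>R x) = 0" and "y \<in> e ` F"
    then obtain d where d: "d \<in> F" "y = e d" by blast
    have "0 = (\<Sum>c\<in>F. a (e c) *\<^sub>R e c) \<bullet> (P *v e d)"
      using sum0 by (simp add: sum.reindex[OF inj])
    also have "\<dots> = (\<Sum>c\<in>F. if c = d then a (e d) * (e d \<bullet> (P *v e d)) else 0)"
      unfolding inner_sum_left using orth d by (intro sum.cong) auto
    also have "\<dots> = a (e d) * (e d \<bullet> (P *v e d))" using F(2) d by simp
    finally show "a y = 0" using pos[of "e d"] e[OF d(1)] d by auto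
  qed (use F in auto)
  then have "card (e ` F) \<le> CARD('n)" using independent_card_le by fastforce
  then show False using F card_image[OF inj] by simp
qed

text \<open>The generalized Rayleigh quotient is scale invariant and so attains a maximum \<open>c\<close>, at some unit
  vector \<open>u\<close>. Then \<open>c P - A\<close> is positive semidefinite and its form vanishes at \<open>u\<close>, which forces
  \<open>(c P - A) u = 0\<close>.\<close>

lemma gen_eigenvalues_nonempty:
  fixes A P :: "real^'n^'n"
  assumes A: "symmetric_matrix A" and P: "symmetric_matrix P"
    and pos: "\<And>v. v \<noteq> 0 \<Longrightarrow> 0 < v \<bullet> (P *v v)"
  shows "gen_eigenvalues A P \<noteq> {}"
proof -
  define R where "R v = (v \<bullet> (A *v v)) / (v \<bullet> (P *v v))" for v
  let ?U = "sphere 0 1 :: (real^'n) set"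
  have nz: "v \<bullet> (P *v v) \<noteq> 0" if "v \<in> ?U" for v
    using pos[of v] that by (cases "v = 0") auto
  have "continuous_on ?U R"
    unfolding R_def by (intro continuous_intros linear_continuous_on_compose
        matrix_vector_mul_linear linear_continuous_on) (use nz in auto)
  moreover have "compact ?U" "?U \<noteq> {}" by auto
  ultimately obtain u where u: "u \<in> ?U" "\<And>v. v \<in> ?U \<Longrightarrow> R v \<le> R u"
    using continuous_attains_sup[of ?U R] by blast
  define c where "c = R u"
  define M where "M = c *\<^sub>R P - A"
  have u0: "u \<noteq> 0" using u by auto
  have form: "x \<bullet> (M *v y) = c * (x \<bullet> (P *v y)) - x \<bullet> (A *v y)" for x y
    by (simp add: M_def matrix_vector_mult_diff_rdistrib inner_diff_right
        scaleR_matrix_vector_assoc[symmetric])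
  have M: "symmetric_matrix M"
    using A P by (simp add: M_def symmetric_matrix_component)
  have zero: "u \<bullet> (M *v u) = 0"
    using pos[OF u0] by (simp add: form c_def R_def)
  have nonneg: "0 \<le> v \<bullet> (M *v v)" for v
  proof (cases "v = 0")
    case False
    define w where "w = inverse (norm v) *\<^sub>R v"
    have "w \<in> ?U" using False by (simp add: w_def)
    then have "R w \<le> c" using u c_def by simp
    moreover have "R w = R v"
      using False by (simp add: R_def w_def matrix_vector_mult_scaleR)
    ultimately have "(v \<bullet> (A *v v)) / (v \<bullet> (P *v v)) \<le> c" by (simp add: R_def)
    then show ?thesis using pos[OF False] by (simp add: form pos_divide_le_eq)
  qed simp
  \<comment> \<open>A vector on which a positive semidefinite form vanishes lies in the kernel: moving from
    \<open>u\<close> in the direction \<open>- z\<close> would otherwise make the form negative to first order.\<close>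
  define z where "z = M *v u"
  have "z = 0"
  proof (rule ccontr)
    assume "z \<noteq> 0"
    define a b where "a = z \<bullet> z" and "b = z \<bullet> (M *v z)"
    have a: "0 < a" using \<open>z \<noteq> 0\<close> by (simp add: a_def)
    have b: "0 \<le> b" by (simp add: b_def nonneg)
    have "u \<bullet> (M *v z) = a"
      using symmetric_matrix_inner_swap[OF M, of u z] by (simp add: a_def z_def)
    then have quad: "(u - t *\<^sub>R z) \<bullet> (M *v (u - t *\<^sub>R z)) = t * (t * b - 2 * a)" for t
      using zero by (simp add: algebra_simps a_def b_def flip: z_def)
    \<comment> \<open>The quadratic is minimal at \<open>a / b\<close>; the summand 1 allows for \<open>b = 0\<close>.\<close>
    define t where "t = a / (b + 1)"
    have "t > 0" "t * b \<le> a" using a b by (auto simp: t_def field_simps)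
    then have "t * (t * b - 2 * a) < 0" using a by (intro mult_pos_neg) auto
    then show False using nonneg[of "u - t *\<^sub>R z"] quad by (metis not_le)
  qed
  then have "A *v u = c *\<^sub>R (P *v u)"
    by (simp add: z_def M_def matrix_vector_mult_diff_rdistrib
        scaleR_matrix_vector_assoc[symmetric])
  then show ?thesis using u0 by (auto simp: gen_eigenvalues_def)
qed

text \<open>The set of generalized eigenvalues must be shown finite and nonempty, since otherwise its
  maximum would be an unspecified number.\<close>

lemma max_gen_eigenvalue_le:
  fixes A P :: "real^'n^'n"
  assumes A: "symmetric_matrix A" and P: "symmetric_matrix P"
    and pos: "\<And>v. v \<noteq> 0 \<Longrightarrow> 0 < v \<bullet> (P *v v)"
    and le: "\<And>v. v \<bullet> (A *v v) \<le> \<mu> * (v \<bullet> (P *v v))"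
  shows "max_gen_eigenvalue A P \<le> \<mu>"
proof -
  have "c \<le> \<mu>" if c: "c \<in> gen_eigenvalues A P" for c
  proof -
    obtain v where v: "v \<noteq> 0" "A *v v = c *\<^sub>R (P *v v)"
      using c by (auto simp: gen_eigenvalues_def)
    then have "c * (v \<bullet> (P *v v)) \<le> \<mu> * (v \<bullet> (P *v v))" using le[of v] by simp
    then show ?thesis using pos[OF v(1)] by simp
  qed
  then show ?thesis
    unfolding max_gen_eigenvalue_def
    using finite_gen_eigenvalues[OF A P pos] gen_eigenvalues_nonempty[OF A P pos] by simp
qed

section \<open>Error of linear interpolation\<close>

text \<open>The total derivative is linear and therefore determined by its values on the standard basis, which
  are the partial derivatives.\<close>

lemma has_derivative_partial:
  fixes g :: "real^'n \<Rightarrow> real"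
  assumes "g differentiable (at x)"
  shows "(g has_derivative (\<lambda>h. \<Sum>i\<in>UNIV. partial i g x * h $ i)) (at x)"
proof -
  have D: "(g has_derivative frechet_derivative g (at x)) (at x)"
    using assms frechet_derivative_works by blast
  then have lin: "linear (frechet_derivative g (at x))"
    by (simp add: has_derivative_bounded_linear bounded_linear.linear)
  have "frechet_derivative g (at x) h = (\<Sum>i\<in>UNIV. partial i g x * h $ i)" for h
  proof -
    have "frechet_derivative g (at x) h
        = frechet_derivative g (at x) (\<Sum>i\<in>UNIV. h $ i *\<^sub>R axis i 1)"
      by (simp add: basis_expansion flip: scalar_mult_eq_scaleR)
    also have "\<dots> = (\<Sum>i\<in>UNIV. partial i g x * h $ i)"
      by (simp add: linear_sum[OF lin] linear_cmul[OF lin] partial_def mult.commute)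
    finally show ?thesis .
  qed
  then show ?thesis using D by presburger
qed

lemma has_real_derivative_along_line:
  fixes g :: "real^'n \<Rightarrow> real"
  assumes "\<And>x. g differentiable (at x)"
  shows "((\<lambda>t. g (x + t *\<^sub>R d)) has_real_derivative
    (\<Sum>i\<in>UNIV. partial i g (x + t *\<^sub>R d) * d $ i)) (at t)"
proof -
  have "((\<lambda>t. x + t *\<^sub>R d) has_derivative (\<lambda>s. s *\<^sub>R d)) (at t)"
    by (auto intro!: derivative_eq_intros)
  from diff_chain_at[OF this has_derivative_partial[OF assms]]
  have "((\<lambda>t. g (x + t *\<^sub>R d)) has_derivative
      (\<lambda>s. \<Sum>i\<in>UNIV. partial i g (x + t *\<^sub>R d) * (s * d $ i))) (at t)"
    by (simp add: o_def)
  moreover have "(\<lambda>s. \<Sum>i\<in>UNIV. partial i g (x + t *\<^sub>R d) * (s * d $ i))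
      = (*) (\<Sum>i\<in>UNIV. partial i g (x + t *\<^sub>R d) * d $ i)"
    by (simp add: fun_eq_iff sum_distrib_left ac_simps)
  ultimately show ?thesis by (simp add: has_field_derivative_def)
qed

lemma segment_in_convex:
  assumes "convex S" "x \<in> S" "y \<in> S" "0 \<le> t" "t \<le> 1"
  shows "x + t *\<^sub>R (y - x) \<in> S"
proof -
  have "(1 - t) *\<^sub>R x + t *\<^sub>R y \<in> S" using assms by (simp add: convex_def)
  then show ?thesis by (simp add: algebra_simps)
qed

text \<open>Mean value theorem along the segment; the 1-norm of the increment produces the factor \<open>\<surd>n\<close>.\<close>

lemma abs_diff_le_of_partial_bound:
  fixes g :: "real^'n \<Rightarrow> real"
  assumes g: "\<And>x. g differentiable (at x)"
    and S: "convex S" "x \<in> S" "y \<in> S"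
    and bound: "\<And>z i. z \<in> S \<Longrightarrow> \<bar>partial i g z\<bar> \<le> b"
  shows "\<bar>g y - g x\<bar> \<le> b * (sqrt (real CARD('n)) * norm (y - x))"
proof -
  define d where "d = y - x"
  obtain z where z: "0 < z" "z < 1" and
    "g (x + 1 *\<^sub>R d) - g (x + 0 *\<^sub>R d) = (1 - 0) * (\<Sum>i\<in>UNIV. partial i g (x + z *\<^sub>R d) * d $ i)"
    using MVT2[of 0 1 "\<lambda>t. g (x + t *\<^sub>R d)" "\<lambda>t. \<Sum>i\<in>UNIV. partial i g (x + t *\<^sub>R d) * d $ i"]
      has_real_derivative_along_line[OF g] by auto
  then have "\<bar>g y - g x\<bar> = \<bar>\<Sum>i\<in>UNIV. partial i g (x + z *\<^sub>R d) * d $ i\<bar>"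
    by (simp add: d_def)
  also have "\<dots> \<le> (\<Sum>i\<in>UNIV. b * \<bar>d $ i\<bar>)"
    using z S by (intro order_trans[OF sum_abs] sum_mono)
      (auto simp: abs_mult d_def intro!: mult_right_mono bound segment_in_convex)
  also have "\<dots> = b * (\<Sum>i\<in>UNIV. \<bar>d $ i\<bar>)" by (simp add: sum_distrib_left)
  also have "\<dots> \<le> b * (sqrt (real CARD('n)) * norm d)"
    using bound[OF S(2)] abs_ge_zero order_trans
    by (intro mult_left_mono sum_abs_components_le) blast
  finally show ?thesis by (simp add: d_def)
qed

text \<open>Second-order Taylor expansion along the segment from \<open>x\<close> to \<open>y\<close>. The second derivative there is
  the quadratic form of the Hessian, whose entries are bounded by \<open>b\<close>.\<close>

lemma abs_taylor_remainder_le: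
  fixes g :: "real^'n \<Rightarrow> real"
  assumes g: "\<And>x. g differentiable (at x)" "\<And>i x. partial i g differentiable (at x)"
    and S: "convex S" "x \<in> S" "y \<in> S"
    and bound: "\<And>z i j. z \<in> S \<Longrightarrow> \<bar>partial i (partial j g) z\<bar> \<le> b"
  shows "\<bar>g y - g x - (\<Sum>i\<in>UNIV. partial i g x * (y - x) $ i)\<bar>
    \<le> real CARD('n) * b / 2 * (norm (y - x))\<^sup>2"
proof -
  define d where "d = y - x"
  define \<phi> \<phi>1 \<phi>2 where "\<phi> t = g (x + t *\<^sub>R d)"
    and "\<phi>1 t = (\<Sum>i\<in>UNIV. partial i g (x + t *\<^sub>R d) * d $ i)"
    and "\<phi>2 t = (\<Sum>i\<in>UNIV. (\<Sum>j\<in>UNIV. partial j (partial i g) (x + t *\<^sub>R d) * d $ j) * d $ i)" for t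
  have 1: "(\<phi> has_real_derivative \<phi>1 t) (at t)" for t
    using has_real_derivative_along_line[OF g(1)] unfolding \<phi>_def \<phi>1_def .
  have 2: "(\<phi>1 has_real_derivative \<phi>2 t) (at t)" for t
    unfolding \<phi>1_def \<phi>2_def
    by (intro DERIV_sum DERIV_cmult_right has_real_derivative_along_line g)
  define df where "df m = (if m = 0 then \<phi> else if m = 1 then \<phi>1 else \<phi>2)" for m :: nat
  have df: "\<forall>m t. m < 2 \<and> 0 \<le> t \<and> t \<le> 1 \<longrightarrow> (df m has_real_derivative df (Suc m) t) (at t)"
    using 1 2 by (auto simp: df_def less_2_cases_iff)
  obtain t where t: "0 < t" "t \<le> 1"
    and eq: "\<phi> 1 = (\<Sum>m<2. df m 0 / fact m * 1 ^ m) + df 2 t / fact 2 * 1 ^ 2"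
    using Maclaurin2[OF zero_less_one _ df, of \<phi>] by (auto simp: df_def)
  have "b \<ge> 0" using bound[OF S(2)] abs_ge_zero order_trans by blast
  have "\<phi>2 t = d \<bullet> ((\<chi> i j. partial j (partial i g) (x + t *\<^sub>R d)) *v d)"
    by (simp add: \<phi>2_def inner_matrix_vector_eq_sum sum_distrib_right sum_distrib_left ac_simps)
  then have "\<bar>\<phi>2 t\<bar> \<le> real CARD('n) * b * (d \<bullet> d)"
    using t S by (auto simp: d_def intro!: abs_quadratic_form_le bound segment_in_convex)
  moreover have "\<phi> 1 = \<phi> 0 + \<phi>1 0 + \<phi>2 t / 2"
    using eq by (simp add: df_def numeral_2_eq_2)
  ultimately show ?thesis
    by (simp add: \<phi>_def \<phi>1_def d_def power2_norm_eq_inner)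
qed

text \<open>Expanding at the interpolation point \<open>x\<close> itself, the weighted first-order terms add up to zero
  because the weighted mean of the nodes is \<open>x\<close>. Only the remainders survive.\<close>

lemma abs_linear_interpolation_error_le:
  fixes g :: "real^'n \<Rightarrow> real"
  assumes g: "\<And>x. g differentiable (at x)" "\<And>i x. partial i g differentiable (at x)"
    and S: "convex S" "V \<subseteq> S" "x \<in> S"
    and u: "\<And>v. v \<in> V \<Longrightarrow> 0 \<le> u v" "(\<Sum>v\<in>V. u v) = 1" "x = (\<Sum>v\<in>V. u v *\<^sub>R v)"
    and h: "\<And>v. v \<in> V \<Longrightarrow> norm (v - x) \<le> h"
    and bound: "\<And>z i j. z \<in> S \<Longrightarrow> \<bar>partial i (partial j g) z\<bar> \<le> b"
  shows "\<bar>g x - (\<Sum>v\<in>V. u v * g v)\<bar> \<le> real CARD('n) * b / 2 * h\<^sup>2"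
proof -
  define L where "L v = (\<Sum>i\<in>UNIV. partial i g x * (v - x) $ i)" for v
  have "b \<ge> 0" using bound[OF S(3)] abs_ge_zero order_trans by blast
  have comp: "(\<Sum>v\<in>V. u v * (v - x) $ i) = 0" for i
  proof -
    have "(\<Sum>v\<in>V. u v * (v - x) $ i) = (\<Sum>v\<in>V. u v *\<^sub>R v) $ i - (\<Sum>v\<in>V. u v) * x $ i"
      by (simp add: right_diff_distrib sum_subtractf sum_distrib_right)
    also have "\<dots> = 0" unfolding u(2) u(3)[symmetric] by simp
    finally show ?thesis .
  qed
  have "(\<Sum>v\<in>V. u v * L v) = (\<Sum>i\<in>UNIV. partial i g x * (\<Sum>v\<in>V. u v * (v - x) $ i))"
    unfolding L_def sum_distrib_left by (subst sum.swap) (simp add: ac_simps)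
  then have L0: "(\<Sum>v\<in>V. u v * L v) = 0" unfolding comp by simp
  have "(\<Sum>v\<in>V. u v * g v) - g x = (\<Sum>v\<in>V. u v * (g v - g x - L v))"
    using u(2) L0 by (simp add: right_diff_distrib sum_subtractf flip: sum_distrib_right)
  then have "\<bar>g x - (\<Sum>v\<in>V. u v * g v)\<bar> = \<bar>\<Sum>v\<in>V. u v * (g v - g x - L v)\<bar>" by linarith
  also have "\<dots> \<le> (\<Sum>v\<in>V. u v * (real CARD('n) * b / 2 * h\<^sup>2))"
  proof (intro order_trans[OF sum_abs] sum_mono)
    fix v assume v: "v \<in> V"
    have "\<bar>g v - g x - L v\<bar> \<le> real CARD('n) * b / 2 * (norm (v - x))\<^sup>2"
      unfolding L_def using v S by (intro abs_taylor_remainder_le[OF g S(1,3) _ bound]) auto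
    also have "\<dots> \<le> real CARD('n) * b / 2 * h\<^sup>2"
      using h[OF v] \<open>b \<ge> 0\<close> by (intro mult_left_mono power_mono) auto
    finally show "\<bar>u v * (g v - g x - L v)\<bar> \<le> u v * (real CARD('n) * b / 2 * h\<^sup>2)"
      unfolding abs_mult abs_of_nonneg[OF u(1)[OF v]] using u(1)[OF v] by (rule mult_left_mono)
  qed
  also have "\<dots> = real CARD('n) * b / 2 * h\<^sup>2"
    unfolding sum_distrib_right[symmetric] u(2) by simp
  finally show ?thesis .
qed

text \<open>With \<open>\<alpha>\<close> the exact weighted mean of the \<open>a v\<close>, the error of the product splits as
  \<open>\<alpha> (\<gamma> - \<Sum> u v c v) - \<Sum> u v (a v - \<alpha>) (c v - \<gamma>)\<close>: the interpolation error of the second factor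
  alone, and a covariance in which both factors are small.\<close>

lemma abs_product_interpolation_error_le:
  fixes a c :: "'v \<Rightarrow> real"
  assumes u: "\<And>v. v \<in> V \<Longrightarrow> 0 \<le> u v" "(\<Sum>v\<in>V. u v) = 1"
    and a: "\<alpha> = (\<Sum>v\<in>V. u v * a v)"
    and c: "\<bar>\<gamma> - (\<Sum>v\<in>V. u v * c v)\<bar> \<le> \<delta>"
    and \<alpha>: "\<bar>\<alpha>\<bar> \<le> K"
    and da: "\<And>v. v \<in> V \<Longrightarrow> \<bar>a v - \<alpha>\<bar> \<le> \<delta>a"
    and dc: "\<And>v. v \<in> V \<Longrightarrow> \<bar>c v - \<gamma>\<bar> \<le> \<delta>c"
  shows "\<bar>\<alpha> * \<gamma> - (\<Sum>v\<in>V. u v * (a v * c v))\<bar> \<le> K * \<delta> + \<delta>a * \<delta>c"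
proof -
  let ?d = "\<Sum>v\<in>V. u v * ((a v - \<alpha>) * (c v - \<gamma>))"
  have "?d = (\<Sum>v\<in>V. u v * (a v * c v)) - \<alpha> * (\<Sum>v\<in>V. u v * c v)
      - \<gamma> * (\<Sum>v\<in>V. u v * a v) + (\<Sum>v\<in>V. u v) * (\<alpha> * \<gamma>)"
    by (simp add: algebra_simps sum.distrib sum_subtractf sum_distrib_left sum_distrib_right)
  then have "?d = (\<Sum>v\<in>V. u v * (a v * c v)) - \<alpha> * (\<Sum>v\<in>V. u v * c v)"
    unfolding u(2) a[symmetric] by simp
  then have eq: "\<alpha> * \<gamma> - (\<Sum>v\<in>V. u v * (a v * c v))
      = \<alpha> * (\<gamma> - (\<Sum>v\<in>V. u v * c v)) - ?d"
    by (simp add: right_diff_distrib)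
  have "\<bar>?d\<bar> \<le> (\<Sum>v\<in>V. u v * (\<delta>a * \<delta>c))"
  proof (intro order_trans[OF sum_abs] sum_mono)
    fix v assume v: "v \<in> V"
    have "\<bar>(a v - \<alpha>) * (c v - \<gamma>)\<bar> \<le> \<delta>a * \<delta>c"
      unfolding abs_mult
      by (intro mult_mono da[OF v] dc[OF v] order_trans[OF abs_ge_zero da[OF v]]) auto
    then show "\<bar>u v * ((a v - \<alpha>) * (c v - \<gamma>))\<bar> \<le> u v * (\<delta>a * \<delta>c)"
      using u(1)[OF v] by (simp add: abs_mult mult_left_mono)
  qed
  also have "\<dots> = \<delta>a * \<delta>c" using u(2) by (simp flip: sum_distrib_right)
  finally have "\<bar>?d\<bar> \<le> \<delta>a * \<delta>c" .
  moreover have "\<bar>\<alpha> * (\<gamma> - (\<Sum>v\<in>V. u v * c v))\<bar> \<le> K * \<delta>"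
    unfolding abs_mult by (intro mult_mono \<alpha> c order_trans[OF abs_ge_zero \<alpha>]) auto
  ultimately show ?thesis unfolding eq by linarith
qed

section \<open>Barycentric coordinates and piecewise affine interpolation\<close>

definition barycentric :: "(real^'n) set \<Rightarrow> (real^'n \<Rightarrow> real) \<Rightarrow> real^'n \<Rightarrow> bool" where
  "barycentric V u x \<longleftrightarrow>
     (\<forall>v\<in>V. 0 \<le> u v) \<and> (\<Sum>v\<in>V. u v) = 1 \<and> x = (\<Sum>v\<in>V. u v *\<^sub>R v)"

lemma barycentric_le_1:
  assumes "finite V" "barycentric V u x" "v \<in> V"
  shows "u v \<le> 1"
  using assms member_le_sum[of v V u] by (auto simp: barycentric_def)

lemma barycentric_unique:
  assumes fin: "finite V" and V: "\<not> affine_dependent V"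
    and u: "barycentric V u x" and u': "barycentric V u' x"
    and v: "v \<in> V"
  shows "u v = u' v"
proof -
  have "(\<Sum>w\<in>V. u w - u' w) = 0" "(\<Sum>w\<in>V. (u w - u' w) *\<^sub>R w) = 0"
    using u u' by (auto simp: barycentric_def sum_subtractf scaleR_diff_left)
  then have "\<not> (\<exists>w\<in>V. u w - u' w \<noteq> 0)"
    using V unfolding affine_dependent_explicit_finite[OF fin] by blast
  then show ?thesis using v by simp
qed

lemma barycentric_extend_zero:
  assumes "finite V" "W \<subseteq> V" "barycentric W u x"
  shows "barycentric V (\<lambda>v. if v \<in> W then u v else 0) x"
proof -
  have "V \<inter> W = W" using assms by blast
  then show ?thesis
    using assms by (auto simp: barycentric_def if_distrib[of "\<lambda>c. c *\<^sub>R _"] sum.inter_restrict[symmetric]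
        cong: if_cong)
qed

lemma ex_barycentric_iff:
  "finite V \<Longrightarrow> x \<in> convex hull V \<longleftrightarrow> (\<exists>u. barycentric V u x)"
  by (auto simp: convex_hull_finite barycentric_def)

lemma simplex_vertices:
  assumes "k simplex S"
  shows "finite (vertices S)" "\<not> affine_dependent (vertices S)"
    "convex hull (vertices S) = S" "int (card (vertices S)) = k + 1"
proof -
  obtain V where V: "\<not> affine_dependent V" "int (card V) = k + 1" "S = convex hull V"
    using assms by (auto simp: simplex_def)
  moreover from this have "vertices S = V" using vertices_convex_hull by blast
  ultimately show "finite (vertices S)" "\<not> affine_dependent (vertices S)"
    "convex hull (vertices S) = S" "int (card (vertices S)) = k + 1"
    using aff_independent_finite by auto
qed

lemma simplex_interior_nonempty:
  fixes S :: "(real^'n) set"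
  assumes "int CARD('n) simplex S"
  shows "interior S \<noteq> {}"
proof -
  have "card (vertices S) = Suc DIM(real^'n)" using simplex_vertices(4)[OF assms] by simp
  then show ?thesis
    using interior_convex_hull_eq_empty simplex_vertices(2,3)[OF assms] by metis
qed

text \<open>The vertices of a face are among those of the simplex, so barycentric coordinates with respect to
  the face, extended by zero, are the coordinates with respect to the simplex.\<close>

lemma common_face_interpolation_agrees:
  fixes p :: "real^'n \<Rightarrow> 'b::real_vector"
  assumes S: "k simplex S" and face: "simplex_face F S" and x: "x \<in> F"
    and u: "barycentric (vertices S) u x"
    and w: "barycentric (vertices F) w x"
  shows "(\<Sum>v\<in>vertices S. u v *\<^sub>R p v) = (\<Sum>v\<in>vertices F. w v *\<^sub>R p v)"
proof -
  note V = simplex_vertices[OF S]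
  obtain W where W: "W \<subset> vertices S" "F = convex hull W"
    using face by (auto simp: simplex_face_def)
  have "\<not> affine_dependent W" using W V affine_independent_subset by blast
  then have F: "vertices F = W" using W vertices_convex_hull by blast
  have "barycentric (vertices S) (\<lambda>v. if v \<in> W then w v else 0) x"
    using barycentric_extend_zero[OF V(1), of W w x] w W(1) F by simp
  then have "u v = (if v \<in> W then w v else 0)" if "v \<in> vertices S" for v
    using barycentric_unique[OF V(1,2) u _ that] by simp
  then have "(\<Sum>v\<in>vertices S. u v *\<^sub>R p v)
      = (\<Sum>v\<in>vertices S. if v \<in> W then w v *\<^sub>R p v else 0)"
    by (intro sum.cong) auto
  also have "\<dots> = (\<Sum>v\<in>W. w v *\<^sub>R p v)"
    using W V(1) by (simp add: Int_absorb1 psubset_imp_subset flip: sum.inter_restrict)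
  finally show ?thesis by (simp add: F)
qed

text \<open>A point lying in two simplices lies in a common face of both, and either interpolation
  equals the one on that face. Hence the definite description in \<open>cpa\<close> has a unique solution, and
  any simplex containing the point may be used to compute it.\<close>

lemma cpa_eq:
  fixes p :: "real^'n \<Rightarrow> 'b::real_vector"
  assumes T: "full_triangulation T" and S: "S \<in> T"
    and u: "barycentric (vertices S) u x"
  shows "cpa T p x = (\<Sum>v\<in>vertices S. u v *\<^sub>R p v)"
  unfolding cpa_def
proof (rule the_equality)
  have full_dim: "int CARD('n) simplex R" if "R \<in> T" for R
    using T that by (simp add: full_triangulation_def)
  note V = simplex_vertices[OF full_dim]
  have in_simplex: "x \<in> R" if "R \<in> T" "barycentric (vertices R) w x" for R w
    using that V(3)[of R] ex_barycentric_iff[OF V(1)[of R]] by blast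
  show "\<exists>R\<in>T. \<exists>w. (\<forall>v\<in>vertices R. 0 \<le> w v \<and> w v \<le> 1) \<and> (\<Sum>v\<in>vertices R. w v) = 1 \<and>
     x = (\<Sum>v\<in>vertices R. w v *\<^sub>R v) \<and>
     (\<Sum>v\<in>vertices S. u v *\<^sub>R p v) = (\<Sum>v\<in>vertices R. w v *\<^sub>R p v)"
    using u S barycentric_le_1[OF V(1)[OF S] u] by (auto simp: barycentric_def)
  fix y
  assume "\<exists>S\<in>T. \<exists>w. (\<forall>v\<in>vertices S. 0 \<le> w v \<and> w v \<le> 1) \<and> (\<Sum>v\<in>vertices S. w v) = 1 \<and>
     x = (\<Sum>v\<in>vertices S. w v *\<^sub>R v) \<and> y = (\<Sum>v\<in>vertices S. w v *\<^sub>R p v)"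
  then obtain R w where R: "R \<in> T" and w: "barycentric (vertices R) w x"
    and y: "y = (\<Sum>v\<in>vertices R. w v *\<^sub>R p v)"
    by (auto simp: barycentric_def)
  show "y = (\<Sum>v\<in>vertices S. u v *\<^sub>R p v)"
  proof (cases "R = S")
    case True
    then show ?thesis
      using y u w barycentric_unique[OF V(1,2)] S by (intro trans[OF y] sum.cong) auto
  next
    case False
    let ?F = "S \<inter> R"
    have x: "x \<in> ?F" using in_simplex u w R S by blast
    then have face: "simplex_face ?F S" "simplex_face ?F R"
      using T R S False unfolding full_triangulation_def by blast+
    \<comment> \<open>\<open>vertices ?F\<close> does not depend on whether \<open>?F\<close> is seen as a face of \<open>S\<close> or of \<open>R\<close>.\<close>
    then obtain W where W: "W \<subset> vertices S" "?F = convex hull W"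
      by (auto simp: simplex_face_def)
    have indep: "\<not> affine_dependent W" using W V(2)[OF S] affine_independent_subset by blast
    then have "vertices ?F = W" using W vertices_convex_hull by metis
    then obtain z where "barycentric (vertices ?F) z x"
      using ex_barycentric_iff[of W x] x W aff_independent_finite[OF indep] by auto
    then show ?thesis
      using y common_face_interpolation_agrees[OF full_dim face(1) x u]
        common_face_interpolation_agrees[OF full_dim face(2) x w] R S by metis
  qed
qed

text \<open>The gradient is recovered from derivatives at interior points, so a nonempty interior is what makes
  it unique.\<close>

lemma simplex_gradient_affine:
  assumes ne: "interior S \<noteq> {}" and g: "\<And>x. x \<in> S \<Longrightarrow> g x = a + w \<bullet> x"
  shows "simplex_gradient S g = w"
  unfolding simplex_gradient_def
proof (rule the_equality)
  have D: "GDERIV g x :> w" if "x \<in> interior S" for x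
  proof -
    have "((\<lambda>x. a + w \<bullet> x) has_derivative (\<lambda>h. h \<bullet> w)) (at x)"
      by (auto intro!: derivative_eq_intros simp: inner_commute)
    then show ?thesis
      unfolding gderiv_def
      by (rule has_derivative_transform_within_open[OF _ open_interior that])
        (use g interior_subset in force)
  qed
  then show "\<forall>x\<in>interior S. GDERIV g x :> w" by blast
  fix w' assume w': "\<forall>x\<in>interior S. GDERIV g x :> w'"
  obtain x where "x \<in> interior S" using ne by blast
  then have "(\<lambda>h. h \<bullet> w') = (\<lambda>h. h \<bullet> w)"
    using D w' has_derivative_unique unfolding gderiv_def by blast
  then show "w' = w" by (metis vector_eq_ldot)
qed

text \<open>The differences to a fixed node \<open>v0\<close> are linearly independent, so a linear functional may be
  prescribed on them.\<close>

lemma ex_affine_interpolant: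
  fixes q :: "real^'n \<Rightarrow> real"
  assumes V: "\<not> affine_dependent V" "V \<noteq> {}"
  shows "\<exists>a w. \<forall>v\<in>V. q v = a + w \<bullet> v"
proof -
  obtain v0 where v0: "v0 \<in> V" using V by blast
  let ?B = "(+) (- v0) ` (V - {v0})"
  have "independent ?B" using V(1) affine_dependent_iff_dependent2[OF v0] by blast
  then obtain L where L: "linear L" "\<And>b. b \<in> ?B \<Longrightarrow> L b = q (b + v0) - q v0"
    using linear_independent_extend[of ?B "\<lambda>b. q (b + v0) - q v0"] by blast
  define w where "w = adjoint L 1"
  have w: "L h = w \<bullet> h" for h
    using adjoint_works[OF L(1), of h 1] by (simp add: w_def inner_commute)
  have "q v = (q v0 - w \<bullet> v0) + w \<bullet> v" if "v \<in> V" for v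
  proof (cases "v = v0")
    case False
    then have "- v0 + v \<in> ?B" using that by blast
    from L(2)[OF this] have "w \<bullet> (v - v0) = q v - q v0" by (simp add: w)
    then show ?thesis by (simp add: inner_diff_right)
  qed simp
  then show ?thesis by blast
qed

text \<open>This ties the abstractly defined gradient to actual increments of the interpolation, valid up to
  the boundary of the simplex and in particular at its vertices.\<close>

lemma cpa_entry_affine:
  fixes p :: "real^'n \<Rightarrow> real^'n^'n"
  assumes T: "full_triangulation T" and S: "S \<in> T"
  obtains a where "\<And>x. x \<in> S \<Longrightarrow> cpa T p x $ i $ j = a + cpa_gradient T p S i j \<bullet> x"
proof -
  have full_dim: "int CARD('n) simplex S" using T S by (simp add: full_triangulation_def)
  note V = simplex_vertices[OF full_dim]
  have "vertices S \<noteq> {}" using V(4) by auto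
  then obtain a w where aw: "\<And>v. v \<in> vertices S \<Longrightarrow> p v $ i $ j = a + w \<bullet> v"
    using ex_affine_interpolant[OF V(2), of "\<lambda>v. p v $ i $ j"] by blast
  have eq: "cpa T p x $ i $ j = a + w \<bullet> x" if x: "x \<in> S" for x
  proof -
    obtain u where u: "barycentric (vertices S) u x"
      using x V(3) ex_barycentric_iff[OF V(1)] by metis
    have "cpa T p x $ i $ j = (\<Sum>v\<in>vertices S. u v * (a + w \<bullet> v))"
      by (simp add: cpa_eq[OF T S u] aw)
    also have "\<dots> = (\<Sum>v\<in>vertices S. u v) * a + w \<bullet> (\<Sum>v\<in>vertices S. u v *\<^sub>R v)"
      by (simp add: distrib_left sum.distrib sum_distrib_right inner_sum_right)
    also have "\<dots> = a + w \<bullet> x" using u by (simp add: barycentric_def)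
    finally show ?thesis .
  qed
  have "cpa_gradient T p S i j = w"
    unfolding cpa_gradient_def
    using simplex_interior_nonempty[OF full_dim] eq by (rule simplex_gradient_affine)
  then show ?thesis using that eq by blast
qed

lemma cpa_vertex:
  assumes T: "full_triangulation T" and S: "S \<in> T" and v: "v \<in> vertices S"
  shows "cpa T p v = p v"
proof -
  have "int CARD('a) simplex S" using T S by (simp add: full_triangulation_def)
  then have fin: "finite (vertices S)" by (rule simplex_vertices)
  have "barycentric (vertices S) (\<lambda>w. if w \<in> {v} then 1 else 0) v"
    by (rule barycentric_extend_zero[OF fin]) (use v in \<open>auto simp: barycentric_def\<close>)
  from cpa_eq[OF T S this, of p] show ?thesis
    using fin v by (simp add: if_distrib[of "\<lambda>c. c *\<^sub>R _"] cong: if_cong)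
qed

lemma symmetric_matrix_cpa:
  fixes p :: "real^'n \<Rightarrow> real^'n^'n"
  assumes T: "full_triangulation T" and S: "S \<in> T" and x: "x \<in> S"
    and sym: "\<And>v. v \<in> vertices S \<Longrightarrow> symmetric_matrix (p v)"
  shows "symmetric_matrix (cpa T p x)"
proof -
  have full_dim: "int CARD('n) simplex S" using T S by (simp add: full_triangulation_def)
  note V = simplex_vertices[OF full_dim]
  obtain u where u: "barycentric (vertices S) u x"
    using x V(3) ex_barycentric_iff[OF V(1)] by metis
  show ?thesis
    unfolding symmetric_matrix_component cpa_eq[OF T S u]
    using sym by (auto simp: symmetric_matrix_component intro!: sum.cong)
qed

lemma cpa_gradient_commute:
  fixes p :: "real^'n \<Rightarrow> real^'n^'n"
  assumes T: "full_triangulation T" and S: "S \<in> T"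
    and sym: "\<And>v. v \<in> vertices S \<Longrightarrow> symmetric_matrix (p v)"
  shows "cpa_gradient T p S j i = cpa_gradient T p S i j"
proof -
  have full_dim: "int CARD('n) simplex S" using T S by (simp add: full_triangulation_def)
  obtain a where a: "\<And>x. x \<in> S \<Longrightarrow> cpa T p x $ i $ j = a + cpa_gradient T p S i j \<bullet> x"
    using cpa_entry_affine[OF T S] by blast
  have "cpa T p x $ j $ i = a + cpa_gradient T p S i j \<bullet> x" if "x \<in> S" for x
    using a[OF that] symmetric_matrix_cpa[OF T S that sym]
    by (simp add: symmetric_matrix_component)
  then show ?thesis
    unfolding cpa_gradient_def[of T p S j i]
    by (rule simplex_gradient_affine[OF simplex_interior_nonempty[OF full_dim]])
qed

section \<open>The matrix \<open>A(x)\<close> under interpolation\<close>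

lemma C_map_3D:
  assumes "C_map 3 f"
  shows "(\<lambda>z. f z $ l) differentiable (at x)"
    and "partial i (\<lambda>z. f z $ l) differentiable (at x)"
    and "partial j (partial i (\<lambda>z. f z $ l)) differentiable (at x)"
  using assms by (simp_all add: C_map_def numeral_3_eq_3)

lemma jacobian_component:
  fixes f :: "real^'n \<Rightarrow> real^'m"
  assumes f: "\<And>l. (\<lambda>z. f z $ l) differentiable (at x)"
  shows "jacobian f (at x) $ m $ j = partial j (\<lambda>z. f z $ m) x"
proof -
  have "(\<lambda>z. \<Sum>l\<in>UNIV. f z $ l *\<^sub>R axis l 1 :: real^'m) differentiable (at x)"
    using f by (intro differentiable_sum differentiable_scaleR differentiable_const) auto
  then have "f differentiable (at x)"
    by (simp add: basis_expansion flip: scalar_mult_eq_scaleR)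
  then have "(f has_derivative frechet_derivative f (at x)) (at x)"
    using frechet_derivative_works by blast
  then have "((\<lambda>z. f z $ m) has_derivative (\<lambda>h. frechet_derivative f (at x) h $ m)) (at x)"
    by (rule bounded_linear.has_derivative[OF bounded_linear_vec_nth])
  then show ?thesis
    by (simp add: partial_def jacobian_def matrix_def flip: frechet_derivative_at)
qed

lemma A_matrix_component:
  fixes f :: "real^'n \<Rightarrow> real^'n"
  assumes f: "\<And>l. (\<lambda>z. f z $ l) differentiable (at x)"
  shows "A_matrix f w M x $ i $ j =
    (\<Sum>m\<in>UNIV. M $ i $ m * partial j (\<lambda>z. f z $ m) x) +
    (\<Sum>m\<in>UNIV. M $ m $ j * partial i (\<lambda>z. f z $ m) x) +
    w i j \<bullet> f x"
  by (simp add: A_matrix_def matrix_matrix_mult_def transpose_def jacobian_component[OF f]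
      mult.commute)

lemma symmetric_A_matrix:
  fixes f :: "real^'n \<Rightarrow> real^'n"
  assumes f: "\<And>l. (\<lambda>z. f z $ l) differentiable (at x)"
    and M: "symmetric_matrix M" and w: "\<And>i j. w i j = w j i"
  shows "symmetric_matrix (A_matrix f w M x)"
  unfolding symmetric_matrix_component
proof (intro allI)
  fix i j
  have "M $ k $ l = M $ l $ k" for k l using M by (simp add: symmetric_matrix_component)
  then show "A_matrix f w M x $ i $ j = A_matrix f w M x $ j $ i"
    unfolding A_matrix_component[OF f] using w[of i j] by (simp add: add.commute)
qed

lemma abs_inner_le_sum_abs:
  fixes w d :: "real^'n"
  assumes "\<And>k. \<bar>d $ k\<bar> \<le> c"
  shows "\<bar>w \<bullet> d\<bar> \<le> (\<Sum>k\<in>UNIV. \<bar>w $ k\<bar>) * c"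
  unfolding inner_vec_def sum_distrib_right
  by (intro order_trans[OF sum_abs] sum_mono) (simp add: abs_mult assms mult_left_mono)

text \<open>Each entry consists of \<open>2 n\<close> products of an entry of \<open>P\<close> with a first partial derivative of
  \<open>f\<close>, and of the scalar product of a constant gradient with \<open>f\<close>. The last one contributes the summand
  \<open>n B D / 2\<close>, and every product contributes \<open>\<surd>n B D + n B3 C / 2\<close>.\<close>

lemma A_matrix_interpolation_error:
  fixes f :: "real^'n \<Rightarrow> real^'n" and P :: "real^'n \<Rightarrow> real^'n^'n"
  assumes f: "C_map 3 f"
    and S: "convex S" "V \<subseteq> S" "x \<in> S"
    and u: "barycentric V u x"
    and h: "\<And>v. v \<in> V \<Longrightarrow> norm (v - x) \<le> h"
    and B: "\<And>z i j k. z \<in> S \<Longrightarrow> \<bar>partial i (partial j (\<lambda>z. f z $ k)) z\<bar> \<le> B"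
    and B3: "\<And>z i j k l. z \<in> S \<Longrightarrow> \<bar>partial i (partial j (partial k (\<lambda>z. f z $ l))) z\<bar> \<le> B3"
    and P: "\<And>y i j. y \<in> S \<Longrightarrow> P y $ i $ j = a i j + w i j \<bullet> y"
    and D: "\<And>i j. (\<Sum>k\<in>UNIV. \<bar>w i j $ k\<bar>) \<le> D"
    and C: "\<And>i j. \<bar>P x $ i $ j\<bar> \<le> C"
  defines "n \<equiv> real CARD('n)"
  shows "\<bar>(A_matrix f w (P x) x - (\<Sum>v\<in>V. u v *\<^sub>R A_matrix f w (P v) v)) $ i $ j\<bar>
    \<le> h\<^sup>2 * (n * B * D / 2 + 2 * n * (sqrt n * B * D + n * B3 * C / 2))"
proof -
  let ?f = "\<lambda>k z. f z $ k"
  note diff = C_map_3D[OF f]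
  have u': "\<And>v. v \<in> V \<Longrightarrow> 0 \<le> u v" "(\<Sum>v\<in>V. u v) = 1" "x = (\<Sum>v\<in>V. u v *\<^sub>R v)"
    using u by (auto simp: barycentric_def)
  have nonneg: "0 \<le> B" "0 \<le> D"
    using B[OF S(3)] D abs_ge_zero order_trans sum_nonneg by (blast, meson)
  have entry: "P x $ k $ l = (\<Sum>v\<in>V. u v * P v $ k $ l)" for k l
  proof -
    have "(\<Sum>v\<in>V. u v * P v $ k $ l) = (\<Sum>v\<in>V. u v * (a k l + w k l \<bullet> v))"
      using P S by (intro sum.cong) auto
    also have "\<dots> = (\<Sum>v\<in>V. u v) * a k l + w k l \<bullet> (\<Sum>v\<in>V. u v *\<^sub>R v)"
      by (simp add: distrib_left sum.distrib sum_distrib_right inner_sum_right)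
    finally show ?thesis using u' P[OF S(3)] by simp
  qed
  have dP: "\<bar>P v $ k $ l - P x $ k $ l\<bar> \<le> D * h" if v: "v \<in> V" for v k l
  proof -
    have "P v $ k $ l - P x $ k $ l = w k l \<bullet> (v - x)"
      using P S v by (simp add: inner_diff_right subset_iff)
    also have "\<bar>\<dots>\<bar> \<le> (\<Sum>m\<in>UNIV. \<bar>w k l $ m\<bar>) * h"
      by (intro abs_inner_le_sum_abs order_trans[OF component_le_norm_cart h[OF v]])
    also have "\<dots> \<le> D * h"
      using D order_trans[OF norm_ge_zero h[OF v]] by (rule mult_right_mono)
    finally show ?thesis .
  qed
  have prod: "\<bar>P x $ k $ l * partial i (?f m) x - (\<Sum>v\<in>V. u v * (P v $ k $ l * partial i (?f m) v))\<bar>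
      \<le> C * (n * B3 / 2 * h\<^sup>2) + (D * h) * (B * (sqrt n * h))" for k l i m
  proof (rule abs_product_interpolation_error_le[OF u'(1,2) entry _ C dP])
    show "\<bar>partial i (?f m) x - (\<Sum>v\<in>V. u v * partial i (?f m) v)\<bar> \<le> n * B3 / 2 * h\<^sup>2"
      unfolding n_def
      by (rule abs_linear_interpolation_error_le[OF diff(2,3) S u' h B3])
    fix v assume v: "v \<in> V"
    have "\<bar>partial i (?f m) v - partial i (?f m) x\<bar> \<le> B * (sqrt n * norm (v - x))"
      unfolding n_def using S v by (intro abs_diff_le_of_partial_bound[OF diff(2) S(1,3) _ B]) auto
    also have "\<dots> \<le> B * (sqrt n * h)"
      by (intro mult_left_mono h[OF v] nonneg) (simp add: n_def)
    finally show "\<bar>partial i (?f m) v - partial i (?f m) x\<bar> \<le> B * (sqrt n * h)" .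
  qed
  define G where "G k l i m = P x $ k $ l * partial i (?f m) x
      - (\<Sum>v\<in>V. u v * (P v $ k $ l * partial i (?f m) v))" for k l i m
  define r where "r = f x - (\<Sum>v\<in>V. u v *\<^sub>R f v)"
  have r: "\<bar>r $ k\<bar> \<le> n * B / 2 * h\<^sup>2" for k
    unfolding r_def n_def
    using abs_linear_interpolation_error_le[OF diff(1,2) S u' h B, of k] by simp
  have wr: "\<bar>w i j \<bullet> r\<bar> \<le> D * (n * B / 2 * h\<^sup>2)"
    using abs_inner_le_sum_abs[OF r]
    by (rule order_trans) (intro mult_right_mono D, simp add: n_def nonneg)
  let ?e = "C * (n * B3 / 2 * h\<^sup>2) + (D * h) * (B * (sqrt n * h))"
  have sums: "\<bar>\<Sum>m\<in>UNIV. G i m j m\<bar> \<le> n * ?e" "\<bar>\<Sum>m\<in>UNIV. G m j i m\<bar> \<le> n * ?e"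
    using sum_bounded_above[of UNIV "\<lambda>m. \<bar>G i m j m\<bar>" ?e]
      sum_bounded_above[of UNIV "\<lambda>m. \<bar>G m j i m\<bar>" ?e] prod
    by (auto simp: G_def n_def intro: order_trans[OF sum_abs])
  have "(A_matrix f w (P x) x - (\<Sum>v\<in>V. u v *\<^sub>R A_matrix f w (P v) v)) $ i $ j
      = (\<Sum>m\<in>UNIV. G i m j m) + (\<Sum>m\<in>UNIV. G m j i m) + w i j \<bullet> r"
    unfolding G_def r_def
    by (simp add: A_matrix_component[OF diff(1)] sum_subtractf distrib_left sum.distrib
        sum_distrib_left inner_diff_right inner_sum_right
        sum.swap[of _ UNIV V])
  then have "\<bar>(A_matrix f w (P x) x - (\<Sum>v\<in>V. u v *\<^sub>R A_matrix f w (P v) v)) $ i $ j\<bar>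
      \<le> n * ?e + n * ?e + D * (n * B / 2 * h\<^sup>2)"
    using sums wr by linarith
  also have "\<dots> = h\<^sup>2 * (n * B * D / 2 + 2 * n * (sqrt n * B * D + n * B3 * C / 2))"
    by (simp add: algebra_simps power2_eq_square)
  finally show ?thesis .
qed

lemma quadratic_form_sum:
  fixes M :: "'v \<Rightarrow> real^'n^'n"
  shows "q \<bullet> ((\<Sum>v\<in>V. u v *\<^sub>R M v) *v q) = (\<Sum>v\<in>V. u v * (q \<bullet> (M v *v q)))"
  by (induction V rule: infinite_finite_induct)
    (simp_all add: matrix_vector_mult_add_rdistrib inner_add_right
      scaleR_matrix_vector_assoc[symmetric])

lemma loewner_geD:
  assumes "loewner_ge M N"
  shows "v \<bullet> (N *v v) \<le> v \<bullet> (M *v v)"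
  using assms by (auto simp: loewner_ge_def pos_semidef_def matrix_vector_mult_diff_rdistrib
      inner_diff_right)

theorem theorem4p10:
  fixes f :: "real^'n \<Rightarrow> real^'n"
    and T :: "(real^'n) set set"
    and \<mu> \<epsilon>\<^sub>0 :: real
    and B B\<^sub>3 C D :: "(real^'n) set \<Rightarrow> real"
    and p :: "real^'n \<Rightarrow> real^'n^'n"
  assumes "C_map 3 f"
    and "full_triangulation T"
    and "\<mu> \<ge> 0"
    and "\<epsilon>\<^sub>0 > 0"
    and "bounds_second f T B"
    and "bounds_third f T B\<^sub>3"
    and "feasible f T \<mu> \<epsilon>\<^sub>0 B B\<^sub>3 p C D"
  shows "\<forall>x\<in>interior (\<Union>T). \<forall>S\<in>T.
    (\<exists>\<theta>>0. \<forall>t\<in>{0..\<theta>}. x + t *\<^sub>R f x \<in> S) \<longrightarrow>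
    \<mu> \<ge> max_gen_eigenvalue (A_matrix f (cpa_gradient T p S) (cpa T p x) x) (cpa T p x)"
proof (intro ballI impI)
  fix x S
  assume S: "S \<in> T" and dir: "\<exists>\<theta>>0. \<forall>t\<in>{0..\<theta>}. x + t *\<^sub>R f x \<in> S"
  \<comment> \<open>At \<open>t = 0\<close> the condition on \<open>S\<close> says that \<open>x\<close> itself lies in \<open>S\<close>.\<close>
  then obtain \<theta> where "\<theta> > 0" "\<forall>t\<in>{0..\<theta>}. x + t *\<^sub>R f x \<in> S" by blast
  then have "x + 0 *\<^sub>R f x \<in> S" by (metis atLeastAtMost_iff less_imp_le order_refl)
  then have x: "x \<in> S" by simp
  note T = \<open>full_triangulation T\<close>
  have full_dim: "int CARD('n) simplex S" using T S by (simp add: full_triangulation_def)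
  note V = simplex_vertices[OF full_dim]
  define V where "V = vertices S"
  have convex: "convex S" and VS: "V \<subseteq> S" and bounded: "bounded S"
    using hull_subset[of "vertices S" convex] convex_convex_hull[of "vertices S"] finite_imp_bounded_convex_hull[OF V(1)]
      V(3) by (auto simp: V_def)
  obtain u where u: "barycentric V u x"
    unfolding V_def using x V(3) ex_barycentric_iff[OF V(1)] by metis
  have u0: "\<And>v. v \<in> V \<Longrightarrow> 0 \<le> u v" and u1: "(\<Sum>v\<in>V. u v) = 1"
    using u by (auto simp: barycentric_def)
  define w where "w = cpa_gradient T p S"
  define P where "P = cpa T p"
  define h where "h = diameter S"
  define n where "n = real CARD('n)"
  define E where "E = E_const TYPE('n) (B S) (B\<^sub>3 S) (C S) (D S)"
  note feas = \<open>feasible f T \<mu> \<epsilon>\<^sub>0 B B\<^sub>3 p C D\<close>[unfolded feasible_def, rule_format, OF S]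
  have C0: "0 \<le> C S" and D0: "0 \<le> D S"
    and D: "\<And>i j. (\<Sum>k\<in>UNIV. \<bar>w i j $ k\<bar>) \<le> D S"
    and sym: "\<And>v. v \<in> V \<Longrightarrow> symmetric_matrix (p v)"
    using feas by (auto simp: w_def V_def)
  have form_mat: "q \<bullet> ((c *\<^sub>R mat 1) *v q) = c * (q \<bullet> q)" for c and q :: "real^'n"
    by (simp flip: scaleR_matrix_vector_assoc)
  have low: "\<epsilon>\<^sub>0 * (q \<bullet> q) \<le> q \<bullet> (p v *v q)"
    and up: "q \<bullet> (p v *v q) \<le> C S * (q \<bullet> q)"
    and decay: "q \<bullet> (A_matrix f w (p v) v *v q)
      \<le> \<mu> * (q \<bullet> (p v *v q)) - h\<^sup>2 * E * (q \<bullet> q)" if v: "v \<in> V" for v q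
  proof -
    have L: "loewner_ge (p v) (\<epsilon>\<^sub>0 *\<^sub>R mat 1)" "loewner_ge (C S *\<^sub>R mat 1) (p v)"
      "loewner_ge 0 (A_matrix f w (p v) v - \<mu> *\<^sub>R p v + (h\<^sup>2 * E) *\<^sub>R mat 1)"
      using feas v unfolding V_def w_def h_def E_def by blast+
    show "\<epsilon>\<^sub>0 * (q \<bullet> q) \<le> q \<bullet> (p v *v q)" "q \<bullet> (p v *v q) \<le> C S * (q \<bullet> q)"
      using loewner_geD[OF L(1), of q] loewner_geD[OF L(2), of q] by (simp_all add: form_mat)
    show "q \<bullet> (A_matrix f w (p v) v *v q) \<le> \<mu> * (q \<bullet> (p v *v q)) - h\<^sup>2 * E * (q \<bullet> q)"
      using loewner_geD[OF L(3), of q]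
      by (simp add: matrix_vector_mult_diff_rdistrib matrix_vector_mult_add_rdistrib
          inner_add_right inner_diff_right form_mat flip: scaleR_matrix_vector_assoc[of \<mu>])
  qed
  have Pv: "P v = p v" if "v \<in> V" for v
    using cpa_vertex[OF T S] that by (simp add: P_def V_def)
  have Px: "P x = (\<Sum>v\<in>V. u v *\<^sub>R p v)"
    using cpa_eq[OF T S] u by (simp add: P_def V_def)
  have formP: "q \<bullet> (P x *v q) = (\<Sum>v\<in>V. u v * (q \<bullet> (p v *v q)))" for q
    unfolding Px by (rule quadratic_form_sum)
  have symP: "symmetric_matrix (P x)"
    using symmetric_matrix_cpa[OF T S x] sym by (simp add: P_def V_def)
  have lowP: "\<epsilon>\<^sub>0 * (q \<bullet> q) \<le> q \<bullet> (P x *v q)" for q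
  proof -
    have "\<epsilon>\<^sub>0 * (q \<bullet> q) = (\<Sum>v\<in>V. u v * (\<epsilon>\<^sub>0 * (q \<bullet> q)))"
      using u1 by (simp flip: sum_distrib_right)
    also have "\<dots> \<le> q \<bullet> (P x *v q)"
      unfolding formP by (intro sum_mono mult_left_mono low u0)
    finally show ?thesis .
  qed
  have upP: "q \<bullet> (P x *v q) \<le> C S * (q \<bullet> q)" for q
  proof -
    have "C S * (q \<bullet> q) = (\<Sum>v\<in>V. u v * (C S * (q \<bullet> q)))"
      using u1 by (simp flip: sum_distrib_right)
    moreover have "q \<bullet> (P x *v q) \<le> (\<Sum>v\<in>V. u v * (C S * (q \<bullet> q)))"
      unfolding formP by (intro sum_mono mult_left_mono up u0)
    ultimately show ?thesis by linarith
  qed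
  have nonnegP: "0 \<le> q \<bullet> (P x *v q)" for q
    using lowP[of q] \<open>\<epsilon>\<^sub>0 > 0\<close> by (meson inner_ge_zero less_imp_le mult_nonneg_nonneg order_trans)
  have C: "\<bar>P x $ i $ j\<bar> \<le> C S" for i j
    using symP nonnegP upP by (rule abs_entry_le_of_quadratic_form_bounds)
  have B: "\<And>z i j k. z \<in> S \<Longrightarrow> \<bar>partial i (partial j (\<lambda>z. f z $ k)) z\<bar> \<le> B S"
    using \<open>bounds_second f T B\<close> S by (auto simp: bounds_second_def)
  have B3: "\<And>z i j k l. z \<in> S \<Longrightarrow>
      \<bar>partial i (partial j (partial k (\<lambda>z. f z $ l))) z\<bar> \<le> B\<^sub>3 S"
    using \<open>bounds_third f T B\<^sub>3\<close> S by (auto simp: bounds_third_def)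
  have B0: "0 \<le> B S" "0 \<le> B\<^sub>3 S"
    using B[OF x] B3[OF x] abs_ge_zero order_trans by blast+
  have h: "norm (v - x) \<le> h" if "v \<in> V" for v
    using diameter_bounded_bound[OF bounded] that VS x by (auto simp: h_def dist_norm)
  have "\<exists>a. \<forall>y\<in>S. P y $ i $ j = a + w i j \<bullet> y" for i j
  proof -
    obtain a where "\<And>y. y \<in> S \<Longrightarrow> P y $ i $ j = a + w i j \<bullet> y"
      unfolding P_def w_def by (rule cpa_entry_affine[OF T S, of p i j]) blast
    then show ?thesis by blast
  qed
  then obtain a where a: "\<And>y i j. y \<in> S \<Longrightarrow> P y $ i $ j = a i j + w i j \<bullet> y" by metis
  define A where "A = A_matrix f w (P x) x"
  define M where "M = (\<Sum>v\<in>V. u v *\<^sub>R A_matrix f w (P v) v)"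
  let ?e = "h\<^sup>2 * (n * B S * D S / 2 + 2 * n * (sqrt n * B S * D S + n * B\<^sub>3 S * C S / 2))"
  have err: "\<bar>(A - M) $ i $ j\<bar> \<le> ?e" for i j
    unfolding A_def M_def n_def
    by (rule A_matrix_interpolation_error[OF \<open>C_map 3 f\<close> convex VS x u h B B3 a D C])
  \<comment> \<open>The margin is twice the error: each of its three terms has twice the coefficient.\<close>
  have "n * ?e = h\<^sup>2 * (n\<^sup>2 * (B S * D S / 2 + 2 * sqrt n * B S * D S + n * B\<^sub>3 S * C S))"
    by (simp add: power2_eq_square algebra_simps)
  also have "\<dots> \<le> h\<^sup>2 * E"
    unfolding E_def E_const_def Let_def n_def[symmetric]
  proof (intro mult_left_mono)
    have "0 \<le> B S * D S" "0 \<le> sqrt n * (B S * D S)" "0 \<le> n * (B\<^sub>3 S * C S)"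
      using B0 C0 D0 by (auto simp: n_def)
    then show "B S * D S / 2 + 2 * sqrt n * B S * D S + n * B\<^sub>3 S * C S
        \<le> (1 + 4 * sqrt n) * B S * D S + 2 * n * B\<^sub>3 S * C S"
      by (simp add: algebra_simps)
  qed auto
  finally have e: "n * ?e \<le> h\<^sup>2 * E" .
  \<comment> \<open>The margin \<open>h\<^sup>2 E\<close> at the vertices outweighs the interpolation error of the quadratic form.\<close>
  have le: "q \<bullet> (A *v q) \<le> \<mu> * (q \<bullet> (P x *v q))" for q
  proof -
    have "q \<bullet> (M *v q) = (\<Sum>v\<in>V. u v * (q \<bullet> (A_matrix f w (p v) v *v q)))"
      unfolding M_def quadratic_form_sum by (simp add: Pv)
    also have "\<dots> \<le> (\<Sum>v\<in>V. u v * (\<mu> * (q \<bullet> (p v *v q)) - h\<^sup>2 * E * (q \<bullet> q)))"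
      by (intro sum_mono mult_left_mono decay u0)
    also have "\<dots> = \<mu> * (q \<bullet> (P x *v q)) - (\<Sum>v\<in>V. u v) * (h\<^sup>2 * E * (q \<bullet> q))"
      unfolding formP
      by (simp add: right_diff_distrib sum_subtractf sum_distrib_left sum_distrib_right ac_simps)
    finally have "q \<bullet> (M *v q) \<le> \<mu> * (q \<bullet> (P x *v q)) - h\<^sup>2 * E * (q \<bullet> q)"
      by (simp add: u1)
    moreover have "q \<bullet> (A *v q) - q \<bullet> (M *v q) \<le> n * ?e * (q \<bullet> q)"
      using abs_quadratic_form_le[of "A - M" ?e q, OF err]
      by (simp add: n_def matrix_vector_mult_diff_rdistrib inner_diff_right)
    moreover have "n * ?e * (q \<bullet> q) \<le> h\<^sup>2 * E * (q \<bullet> q)"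
      by (rule mult_right_mono[OF e]) simp
    ultimately show ?thesis by linarith
  qed
  have "symmetric_matrix A"
    unfolding A_def
    using C_map_3D(1)[OF \<open>C_map 3 f\<close>] symP cpa_gradient_commute[OF T S sym]
    unfolding w_def V_def by (rule symmetric_A_matrix)
  moreover have "0 < q \<bullet> (P x *v q)" if "q \<noteq> 0" for q
    using lowP[of q] \<open>\<epsilon>\<^sub>0 > 0\<close> that by (smt (verit) inner_gt_zero_iff mult_pos_pos)
  ultimately have "max_gen_eigenvalue A (P x) \<le> \<mu>"
    using symP le by (intro max_gen_eigenvalue_le)
  then show "\<mu> \<ge> max_gen_eigenvalue (A_matrix f (cpa_gradient T p S) (cpa T p x) x) (cpa T p x)"
    by (simp add: A_def P_def w_def)
qed

end
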